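(* If $\mathcal{C}$ is one of the clones $\Lambda$ and $V$ of Boolean functions, then the class $\mathcal{C}^{(\geq 4)}$ is reconstructible.
   Context: A Boolean function is a map $f\colon\{0,1\}^n\to\{0,1\}$, $n\ge1$ (its arity). $\Lambda$ is the clone of all polynomial operations of the two-element meet-semilattice $(\{0,1\};\wedge)$ (all constant functions and all conjunctions of a nonempty set of arguments); $V$ is the clone of all polynomial operations of the two-element join-semilattice $(\{0,1\};\vee)$ (all constant functions and all disjunctions of a nonempty set of arguments). Functions may have inessential arguments. $\mathcal C^{(\ge n)}$ is the set of members of $\mathcal C$ of arity at least $n$. For functions $f,g$ of the same arity $n$, $f\equiv g$ (equivalent) means that there is a permutation $\sigma$ of $\{1,\dots,n\}$ with $f(a_1,\dots,a_n)=g(a_{\sigma(1)},\dots,a_{\sigma(n)})$ for all $(a_1,\dots,a_n)$. For $f$ of arity $n\ge2$ and $I=\{i,j\}\subseteq\{1,\dots,n\}$, $i<j$, the identification minor $f_I$ is the function of arity $n-1$ given by $f_I(a_1,\dots,a_{n-1})=f(a_1,\dots,a_{j-1},a_i,a_j,\dots,a_{n-1})$. The deck of $f$ is the multiset of the equivalence classes $f_I/{\equiv}$ over all two-element $I\subseteq\{1,\dots,n\}$. A reconstruction of $f$ is a Boolean function of the same arity with the same deck; $f$ is reconstructible if it is equivalent to all of its reconstructions; a class is reconstructible if all of its members are reconstructible. *)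

theory Defs
  imports "HOL-Combinatorics.Permutations" "HOL-Library.FuncSet" "HOL-Library.Multiset"
begin

section \<open>Boolean functions\<close>

text \<open>
  The set \<open>{0,1}\<close> is \<^typ>\<open>bool\<close> (with 0 as \<^const>\<open>False\<close>); an \<open>n\<close>-tuple is a list of length
  \<open>n\<close>, so that argument positions are \<open>0, \<dots>, n - 1\<close>. The extensional function space makes the
  values on lists of any other length irrelevant. An element of it need not determine its arity,
  which is therefore always carried along explicitly.
\<close>

definition tuples :: "nat \<Rightarrow> bool list set" where
  "tuples n = {a. length a = n}"

definition bool_funs :: "nat \<Rightarrow> (bool list \<Rightarrow> bool) set" where
  "bool_funs n = tuples n \<rightarrow>\<^sub>E (UNIV :: bool set)"

text \<open>Sets of Boolean functions of various arities consist of pairs of an arity and a function.\<close>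

type_synonym fun_class = "(nat \<times> (bool list \<Rightarrow> bool)) set"

definition arity_at_least :: "fun_class \<Rightarrow> nat \<Rightarrow> fun_class" where
  "arity_at_least C m = {(n, f). (n, f) \<in> C \<and> n \<ge> m}"


section \<open>Polynomial operations and the two clones\<close>

inductive_set polynomial_operations :: "(bool \<Rightarrow> bool \<Rightarrow> bool) \<Rightarrow> fun_class"
  for b :: "bool \<Rightarrow> bool \<Rightarrow> bool" where
  projection: "i < n \<Longrightarrow> (n, \<lambda>a\<in>tuples n. a ! i) \<in> polynomial_operations b"
| const: "n \<ge> 1 \<Longrightarrow> (n, \<lambda>a\<in>tuples n. c) \<in> polynomial_operations b"
| application: "(n, f) \<in> polynomial_operations b \<Longrightarrow> (n, g) \<in> polynomial_operations b \<Longrightarrow>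
    (n, \<lambda>a\<in>tuples n. b (f a) (g a)) \<in> polynomial_operations b"

definition clone_Lambda :: fun_class where
  "clone_Lambda = polynomial_operations (\<and>)"

definition clone_V :: fun_class where
  "clone_V = polynomial_operations (\<or>)"


section \<open>Equivalence, identification minors and decks\<close>

text \<open>\<^term>\<open>permute_list \<sigma> a\<close> is the tuple whose \<open>i\<close>-th entry is \<^term>\<open>a ! \<sigma> i\<close>.\<close>

definition fun_equiv :: "nat \<Rightarrow> ((bool list \<Rightarrow> bool) \<times> (bool list \<Rightarrow> bool)) set" where
  "fun_equiv n = {(f, g). f \<in> bool_funs n \<and> g \<in> bool_funs n \<and>
     (\<exists>\<sigma>. \<sigma> permutes {..<n} \<and> (\<forall>a\<in>tuples n. f a = g (permute_list \<sigma> a)))}"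

text \<open>
  For \<open>i < j\<close> and \<open>I = {i, j}\<close>, the entry at position \<open>i\<close> of an \<open>(n - 1)\<close>-tuple is duplicated by
  inserting a copy of it at position \<open>j\<close>.
\<close>

definition identification_minor ::
    "nat \<Rightarrow> (bool list \<Rightarrow> bool) \<Rightarrow> nat set \<Rightarrow> (bool list \<Rightarrow> bool)" where
  "identification_minor n f I =
     (\<lambda>a\<in>tuples (n - 1). f (take (Max I) a @ a ! Min I # drop (Max I) a))"

definition deck :: "nat \<Rightarrow> (bool list \<Rightarrow> bool) \<Rightarrow> (bool list \<Rightarrow> bool) set multiset" where
  "deck n f = image_mset (\<lambda>I. fun_equiv (n - 1) `` {identification_minor n f I})
     (mset_set {I. I \<subseteq> {..<n} \<and> card I = 2})"


section \<open>Reconstructibility\<close>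

definition is_reconstruction :: "nat \<Rightarrow> (bool list \<Rightarrow> bool) \<Rightarrow> (bool list \<Rightarrow> bool) \<Rightarrow> bool" where
  "is_reconstruction n f g \<longleftrightarrow> g \<in> bool_funs n \<and> deck n g = deck n f"

definition reconstructible :: "nat \<Rightarrow> (bool list \<Rightarrow> bool) \<Rightarrow> bool" where
  "reconstructible n f \<longleftrightarrow> (\<forall>g. is_reconstruction n f g \<longrightarrow> (f, g) \<in> fun_equiv n)"

definition reconstructible_class :: "fun_class \<Rightarrow> bool" where
  "reconstructible_class C \<longleftrightarrow> (\<forall>(n, f) \<in> C. reconstructible n f)"


section \<open>Consistency of the definitions\<close>

lemma equiv_fun_equiv: "equiv (bool_funs n) (fun_equiv n)"
proof (rule equivI)
  show "fun_equiv n \<subseteq> bool_funs n \<times> bool_funs n"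
    by (auto simp: fun_equiv_def)
  show "refl_on (bool_funs n) (fun_equiv n)"
    unfolding refl_on_def fun_equiv_def by (auto intro!: exI[of _ id] permutes_id)
  show "sym (fun_equiv n)"
  proof (rule symI)
    fix f g assume "(f, g) \<in> fun_equiv n"
    then obtain s where s: "f \<in> bool_funs n" "g \<in> bool_funs n" "s permutes {..<n}"
      "\<And>a. length a = n \<Longrightarrow> f a = g (permute_list s a)"
      by (auto simp: fun_equiv_def tuples_def)
    have "g a = f (permute_list (inv s) a)" if "length a = n" for a
    proof -
      have "permute_list s (permute_list (inv s) a) = a"
        using permute_list_compose[of s a "inv s"] s(3) that permutes_inv_o(2)[OF s(3)] by simp
      then show ?thesis using s(4)[of "permute_list (inv s) a"] that by simp
    qed
    then show "(g, f) \<in> fun_equiv n"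
      using s(1,2) permutes_inv[OF s(3)] unfolding fun_equiv_def tuples_def by blast
  qed
  show "trans (fun_equiv n)"
  proof (rule transI)
    fix f g h assume "(f, g) \<in> fun_equiv n" "(g, h) \<in> fun_equiv n"
    then obtain s t where s: "f \<in> bool_funs n" "h \<in> bool_funs n" "s permutes {..<n}"
        "t permutes {..<n}"
      and e: "\<And>a. length a = n \<Longrightarrow> f a = g (permute_list s a)"
        "\<And>a. length a = n \<Longrightarrow> g a = h (permute_list t a)"
      by (auto simp: fun_equiv_def tuples_def)
    have "f a = h (permute_list (s \<circ> t) a)" if "length a = n" for a
      using permute_list_compose[of t a s] s(4) that e by simp
    then show "(f, h) \<in> fun_equiv n"
      using s permutes_compose[OF s(4,3)] by (auto simp: fun_equiv_def tuples_def)
  qed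
qed

lemma polynomial_operations_bool_funs:
  "(n, f) \<in> polynomial_operations b \<Longrightarrow> n \<ge> 1 \<and> f \<in> bool_funs n"
  by (induction n f rule: polynomial_operations.induct) (auto simp: bool_funs_def)

lemma clone_Lambda_iff:
  "(n, f) \<in> clone_Lambda \<longleftrightarrow> n \<ge> 1 \<and>
     ((\<exists>c. f = (\<lambda>a\<in>tuples n. c)) \<or>
      (\<exists>S. S \<noteq> {} \<and> S \<subseteq> {..<n} \<and> f = (\<lambda>a\<in>tuples n. \<forall>i\<in>S. a ! i)))"
  (is "_ \<longleftrightarrow> _ \<and> ?P n f")
proof
  assume "(n, f) \<in> clone_Lambda"
  then show "n \<ge> 1 \<and> ?P n f" unfolding clone_Lambda_def
  proof (induction n f rule: polynomial_operations.induct)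
    case (projection i n)
    then have "n \<ge> 1" by simp
    moreover have "(\<lambda>a\<in>tuples n. a ! i) = (\<lambda>a\<in>tuples n. \<forall>i\<in>{i}. a ! i)" by simp
    ultimately show ?case using projection
      by (metis empty_subsetI insert_not_empty insert_subset lessThan_iff)
  next
    case (const n c)
    then show ?case by blast
  next
    case (application n f g)
    let ?h = "\<lambda>a\<in>tuples n. f a \<and> g a"
    have n: "n \<ge> 1" and f: "?P n f" and g: "?P n g" using application.IH by auto
    consider (const_l) c where "f = (\<lambda>a\<in>tuples n. c)" | (const_r) c where "g = (\<lambda>a\<in>tuples n. c)"
      | (conj) S T where "S \<noteq> {}" "S \<subseteq> {..<n}" "f = (\<lambda>a\<in>tuples n. \<forall>i\<in>S. a ! i)"
          "T \<subseteq> {..<n}" "g = (\<lambda>a\<in>tuples n. \<forall>i\<in>T. a ! i)"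
      using f g by blast
    then have "?P n ?h"
    proof cases
      case const_l
      have "g a = undefined" if "a \<notin> tuples n" for a using g that by auto
      then have "?h = (if c then g else (\<lambda>a\<in>tuples n. False))"
        unfolding const_l by (auto simp: fun_eq_iff restrict_def)
      then show ?thesis using g by (cases c) auto
    next
      case const_r
      have "f a = undefined" if "a \<notin> tuples n" for a using f that by auto
      then have "?h = (if c then f else (\<lambda>a\<in>tuples n. False))"
        unfolding const_r by (auto simp: fun_eq_iff restrict_def)
      then show ?thesis using f by (cases c) auto
    next
      case conj
      have "?h = (\<lambda>a\<in>tuples n. \<forall>i\<in>S \<union> T. a ! i)"
        unfolding conj by (auto simp: fun_eq_iff restrict_def)
      then show ?thesis using conj by (intro disjI2 exI[of _ "S \<union> T"]) auto
    qed
    then show ?case using n by blast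
  qed
next
  have *: "(n, \<lambda>a\<in>tuples n. \<forall>i\<in>S. a ! i) \<in> clone_Lambda"
    if "finite S" "S \<noteq> {}" "S \<subseteq> {..<n}" for S
    using that unfolding clone_Lambda_def
  proof (induction S rule: finite_ne_induct)
    case (singleton x)
    have "(\<lambda>a\<in>tuples n. \<forall>i\<in>{x}. a ! i) = (\<lambda>a\<in>tuples n. a ! x)" by simp
    then show ?case using singleton polynomial_operations.projection[of x n "(\<and>)"]
      by (metis insert_subset lessThan_iff)
  next
    case (insert x F)
    have "(n, \<lambda>a\<in>tuples n. a ! x) \<in> polynomial_operations (\<and>)"
      using insert.prems by (intro polynomial_operations.projection) auto
    from polynomial_operations.application[OF this insert.IH] insert.prems
    have "(n, \<lambda>a\<in>tuples n. (\<lambda>a\<in>tuples n. a ! x) a \<and>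
        (\<lambda>a\<in>tuples n. \<forall>i\<in>F. a ! i) a) \<in> polynomial_operations (\<and>)"
      by blast
    also have "(\<lambda>a\<in>tuples n. (\<lambda>a\<in>tuples n. a ! x) a \<and>
        (\<lambda>a\<in>tuples n. \<forall>i\<in>F. a ! i) a) = (\<lambda>a\<in>tuples n. \<forall>i\<in>insert x F. a ! i)"
      by (rule restrict_ext) simp
    finally show ?case .
  qed
  assume "n \<ge> 1 \<and> ?P n f"
  then show "(n, f) \<in> clone_Lambda"
    using * finite_subset[OF _ finite_lessThan[of n]]
      polynomial_operations.const[of n _ "(\<and>)", folded clone_Lambda_def]
    by blast
qed

lemma clone_V_iff:
  "(n, f) \<in> clone_V \<longleftrightarrow> n \<ge> 1 \<and>
     ((\<exists>c. f = (\<lambda>a\<in>tuples n. c)) \<or>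
      (\<exists>S. S \<noteq> {} \<and> S \<subseteq> {..<n} \<and> f = (\<lambda>a\<in>tuples n. \<exists>i\<in>S. a ! i)))"
  (is "_ \<longleftrightarrow> _ \<and> ?P n f")
proof
  assume "(n, f) \<in> clone_V"
  then show "n \<ge> 1 \<and> ?P n f" unfolding clone_V_def
  proof (induction n f rule: polynomial_operations.induct)
    case (projection i n)
    then have "n \<ge> 1" by simp
    moreover have "(\<lambda>a\<in>tuples n. a ! i) = (\<lambda>a\<in>tuples n. \<exists>i\<in>{i}. a ! i)" by simp
    ultimately show ?case using projection
      by (metis empty_subsetI insert_not_empty insert_subset lessThan_iff)
  next
    case (const n c)
    then show ?case by blast
  next
    case (application n f g)
    let ?h = "\<lambda>a\<in>tuples n. f a \<or> g a"
    have n: "n \<ge> 1" and f: "?P n f" and g: "?P n g" using application.IH by auto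
    consider (const_l) c where "f = (\<lambda>a\<in>tuples n. c)" | (const_r) c where "g = (\<lambda>a\<in>tuples n. c)"
      | (disj) S T where "S \<noteq> {}" "S \<subseteq> {..<n}" "f = (\<lambda>a\<in>tuples n. \<exists>i\<in>S. a ! i)"
          "T \<subseteq> {..<n}" "g = (\<lambda>a\<in>tuples n. \<exists>i\<in>T. a ! i)"
      using f g by blast
    then have "?P n ?h"
    proof cases
      case const_l
      have "g a = undefined" if "a \<notin> tuples n" for a using g that by auto
      then have "?h = (if c then (\<lambda>a\<in>tuples n. True) else g)"
        unfolding const_l by (auto simp: fun_eq_iff restrict_def)
      then show ?thesis using g by (cases c) auto
    next
      case const_r
      have "f a = undefined" if "a \<notin> tuples n" for a using f that by auto
      then have "?h = (if c then (\<lambda>a\<in>tuples n. True) else f)"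
        unfolding const_r by (auto simp: fun_eq_iff restrict_def)
      then show ?thesis using f by (cases c) auto
    next
      case disj
      have "?h = (\<lambda>a\<in>tuples n. \<exists>i\<in>S \<union> T. a ! i)"
        unfolding disj by (auto simp: fun_eq_iff restrict_def)
      then show ?thesis using disj by (intro disjI2 exI[of _ "S \<union> T"]) auto
    qed
    then show ?case using n by blast
  qed
next
  have *: "(n, \<lambda>a\<in>tuples n. \<exists>i\<in>S. a ! i) \<in> clone_V"
    if "finite S" "S \<noteq> {}" "S \<subseteq> {..<n}" for S
    using that unfolding clone_V_def
  proof (induction S rule: finite_ne_induct)
    case (singleton x)
    have "(\<lambda>a\<in>tuples n. \<exists>i\<in>{x}. a ! i) = (\<lambda>a\<in>tuples n. a ! x)" by simp
    then show ?case using singleton polynomial_operations.projection[of x n "(\<or>)"]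
      by (metis insert_subset lessThan_iff)
  next
    case (insert x F)
    have "(n, \<lambda>a\<in>tuples n. a ! x) \<in> polynomial_operations (\<or>)"
      using insert.prems by (intro polynomial_operations.projection) auto
    from polynomial_operations.application[OF this insert.IH] insert.prems
    have "(n, \<lambda>a\<in>tuples n. (\<lambda>a\<in>tuples n. a ! x) a \<or>
        (\<lambda>a\<in>tuples n. \<exists>i\<in>F. a ! i) a) \<in> polynomial_operations (\<or>)"
      by blast
    also have "(\<lambda>a\<in>tuples n. (\<lambda>a\<in>tuples n. a ! x) a \<or>
        (\<lambda>a\<in>tuples n. \<exists>i\<in>F. a ! i) a) = (\<lambda>a\<in>tuples n. \<exists>i\<in>insert x F. a ! i)"
      by (rule restrict_ext) simp
    finally show ?case .
  qed
  assume "n \<ge> 1 \<and> ?P n f"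
  then show "(n, f) \<in> clone_V"
    using * finite_subset[OF _ finite_lessThan[of n]]
      polynomial_operations.const[of n _ "(\<or>)", folded clone_V_def]
    by blast
qed

end

theory Submission
  imports Defs
begin

text \<open>
  Up to relabelling, the minor of \<open>f\<close> at \<open>{i, j}\<close> is the restriction of \<open>f\<close> to the tuples with
  \<open>a\<^sub>i = a\<^sub>j\<close>. If \<open>f\<close> is a conjunction over \<open>S\<close>, then all its minors preserve meets, and so do those of
  a reconstruction \<open>g\<close>. Hence \<open>g (a \<and> b) = (g a \<and> g b)\<close> whenever some \<open>i \<noteq> j\<close> satisfy both
  \<open>a\<^sub>i = a\<^sub>j\<close> and \<open>b\<^sub>i = b\<^sub>j\<close>. Such a pair fails to exist only for \<open>n = 4\<close> and tuples \<open>a, b\<close> that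
  realise all four combinations of values; there the numbers of true points of the minors still force
  the identity. So \<open>g\<close> is a conjunction over some \<open>T\<close>, and \<open>card T = card S\<close> again follows by
  counting true points of minors.
  Disjunctions are handled by duality, constant functions by the pigeonhole principle.
\<close>

section \<open>Counting true points\<close>

text \<open>
  Tuples are encoded by the sets of positions of their 1s, so \<open>I \<subseteq> A \<or> I \<inter> A = {}\<close> says that the
  tuple is constant on \<open>I\<close>.
\<close>

definition true_count :: "'a set \<Rightarrow> ('a set \<Rightarrow> bool) \<Rightarrow> 'a set \<Rightarrow> nat" where
  "true_count U G I = card {A. A \<subseteq> U \<and> (I \<subseteq> A \<or> I \<inter> A = {}) \<and> G A}"

definition pairs :: "'a set \<Rightarrow> 'a set set" where
  "pairs U = {I. I \<subseteq> U \<and> card I = 2}"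

lemma true_count_cong:
  assumes "\<And>A. A \<subseteq> U \<Longrightarrow> I \<subseteq> A \<or> I \<inter> A = {} \<Longrightarrow> G A \<longleftrightarrow> H A"
  shows "true_count U G I = true_count U H I"
  using assms unfolding true_count_def by (metis (mono_tags, lifting) Collect_cong)

section \<open>True points of the minors of a conjunction\<close>

lemma card_supersets:
  assumes "finite U" "S \<subseteq> U"
  shows "card {A. A \<subseteq> U \<and> S \<subseteq> A} = 2 ^ (card U - card S)"
proof -
  have "bij_betw (\<lambda>A. A \<union> S) (Pow (U - S)) {A. A \<subseteq> U \<and> S \<subseteq> A}"
    by (rule bij_betw_byWitness[where f' = "\<lambda>A. A - S"]) (use assms in auto)
  then have "card {A. A \<subseteq> U \<and> S \<subseteq> A} = card (Pow (U - S))"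
    by (simp add: bij_betw_same_card)
  then show ?thesis
    using assms by (simp add: card_Pow card_Diff_subset finite_subset)
qed

lemma true_count_conj_inside:
  assumes "finite U" "S \<subseteq> U" "I \<subseteq> S"
  shows "true_count U (\<lambda>A. S \<subseteq> A) I = 2 ^ (card U - card S)"
proof -
  have "{A. A \<subseteq> U \<and> (I \<subseteq> A \<or> I \<inter> A = {}) \<and> S \<subseteq> A} = {A. A \<subseteq> U \<and> S \<subseteq> A}"
    using assms by auto
  then show ?thesis
    using card_supersets[OF assms(1,2)] by (simp add: true_count_def)
qed

text \<open>A position \<open>j\<close> of \<open>I\<close> outside \<open>S\<close> is tied to the
  other position \<open>i\<close>, so deleting \<open>j\<close> loses no information and leaves the
  supersets of \<open>S\<close> in \<open>U - {j}\<close>, whether or not \<open>i\<close> lies in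
  \<open>S\<close>. Such a pair has half as many true points as a pair inside
  \<open>S\<close>.\<close>

lemma true_count_conj_outside:
  assumes "finite U" "S \<subseteq> U" "I \<in> pairs U" "\<not> I \<subseteq> S"
  shows "true_count U (\<lambda>A. S \<subseteq> A) I = 2 ^ (card U - 1 - card S)"
proof -
  obtain j where j: "j \<in> I" "j \<notin> S" using assms by auto
  with assms obtain i where I: "I = {i, j}" "i \<noteq> j" "i \<in> U" "j \<in> U"
    unfolding pairs_def by (auto simp: card_2_iff)
  have "bij_betw (\<lambda>A. A - {j})
      {A. A \<subseteq> U \<and> (I \<subseteq> A \<or> I \<inter> A = {}) \<and> S \<subseteq> A} {A. A \<subseteq> U - {j} \<and> S \<subseteq> A}"
    by (rule bij_betw_byWitness[where f' = "\<lambda>A. if i \<in> A then insert j A else A"])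
      (use I j assms in \<open>auto split: if_splits\<close>)
  then have "true_count U (\<lambda>A. S \<subseteq> A) I = card {A. A \<subseteq> U - {j} \<and> S \<subseteq> A}"
    by (simp add: bij_betw_same_card true_count_def)
  also have "\<dots> = 2 ^ (card (U - {j}) - card S)"
    by (rule card_supersets) (use assms j in auto)
  finally show ?thesis using I assms by simp
qed

lemma pair_inside_exists:
  assumes "finite T" "card T \<ge> 2" "T \<subseteq> U"
  shows "\<exists>I\<in>pairs U. I \<subseteq> T"
proof -
  obtain I where "I \<subseteq> T" "card I = 2" using obtain_subset_with_card_n[OF assms(2)] by metis
  then show ?thesis using assms by (auto simp: pairs_def)
qed

text \<open>The set of values alone, without multiplicities, determines the size of the index set.
  Unless \<open>S = U\<close>, the smallest count for \<open>S\<close> is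
  \<open>2 ^ (card U - 1 - card S)\<close>, which would undercut every count for \<open>T\<close>.
  For \<open>S = U\<close> all counts are 1, while a smaller \<open>T\<close> has a larger
  count.\<close>

lemma true_count_conj_less:
  assumes U: "finite U" "card U \<ge> 3" and S: "S \<subseteq> U" and T: "T \<subseteq> U"
    and eq: "true_count U (\<lambda>A. S \<subseteq> A) ` pairs U = true_count U (\<lambda>A. T \<subseteq> A) ` pairs U"
  shows "\<not> card T < card S"
proof
  assume less: "card T < card S"
  have fin: "finite S" "finite T" using U S T finite_subset by auto
  have le: "card S \<le> card U" using S U card_mono by auto
  have low: "true_count U (\<lambda>A. T \<subseteq> A) I \<ge> 2 ^ (card U - 1 - card T)" if "I \<in> pairs U" for I
    using true_count_conj_inside[OF U(1) T] true_count_conj_outside[OF U(1) T that]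
    by (cases "I \<subseteq> T") auto
  show False
  proof (cases "S = U")
    case False
    then obtain x where x: "x \<in> U" "x \<notin> S" using S by auto
    have "card (U - {x}) > 0" using U x by simp
    then obtain y where y: "y \<in> U" "y \<noteq> x" using U(1) by (auto simp: card_gt_0_iff)
    have I: "{x, y} \<in> pairs U" using x y by (auto simp: pairs_def)
    have "card S < card U" using False S U psubset_card_mono by blast
    then have "(2::nat) ^ (card U - 1 - card S) < 2 ^ (card U - 1 - card T)"
      using less by (intro power_strict_increasing) auto
    moreover have "true_count U (\<lambda>A. S \<subseteq> A) {x, y} = 2 ^ (card U - 1 - card S)"
      using true_count_conj_outside[OF U(1) S I] x by auto
    ultimately show False using low I eq by (metis (no_types, lifting) imageE imageI leD)
  next
    case True
    have one: "true_count U (\<lambda>A. S \<subseteq> A) I = 1" if "I \<in> pairs U" for I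
      using true_count_conj_inside[OF U(1) S, of I] that True by (auto simp: pairs_def)
    \<comment> \<open>If \<open>card T = card U - 1\<close>, the pairs outside \<open>T\<close> also
      give 1, so a pair inside \<open>T\<close> is chosen whenever there is one. Otherwise
      \<open>T\<close> has at most one element, and \<open>card U \<ge> 3\<close> makes the bound
      \<open>low\<close> exceed 1.\<close>
    have "\<exists>I\<in>pairs U. true_count U (\<lambda>A. T \<subseteq> A) I > 1"
    proof (cases "card T \<ge> 2")
      case c: True
      obtain I where I: "I \<in> pairs U" "I \<subseteq> T" using pair_inside_exists[OF fin(2) c T] by auto
      then have "true_count U (\<lambda>A. T \<subseteq> A) I = 2 ^ (card U - card T)"
        using true_count_conj_inside[OF U(1) T] by blast
      moreover have "(2::nat) ^ (card U - card T) > 1"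
        using less le by (intro one_less_power) auto
      ultimately show ?thesis using I by (intro bexI[of _ I]) auto
    next
      case c: False
      obtain I where I: "I \<in> pairs U" using pair_inside_exists[of U U] U by auto
      have "(2::nat) ^ (card U - 1 - card T) > 1"
        using U c by (intro one_less_power) auto
      then show ?thesis using low[OF I] I by (intro bexI[of _ I]) auto
    qed
    then show False using one eq by (metis (no_types, lifting) imageE imageI less_irrefl)
  qed
qed

text \<open>The hypothesis \<open>meet\<close> covers only sets \<open>A\<close>, \<open>B\<close>
  that fail to separate some two positions. Once it is extended to all subsets of \<open>U\<close>,
  the true sets form a principal filter generated by their intersection \<open>T\<close>, and the
  counts determine the size of \<open>T\<close>. The counts are also what excludes the one pattern
  beyond the reach of \<open>meet\<close>.\<close>

lemma conj_of_minor_counts: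
  fixes U :: "'a set"
  assumes U: "finite U" "card U \<ge> 4" and S: "S \<subseteq> U"
    and meet: "\<And>x y A B. x \<in> U \<Longrightarrow> y \<in> U \<Longrightarrow> x \<noteq> y \<Longrightarrow> A \<subseteq> U \<Longrightarrow> B \<subseteq> U \<Longrightarrow>
      (x \<in> A \<longleftrightarrow> y \<in> A) \<Longrightarrow> (x \<in> B \<longleftrightarrow> y \<in> B) \<Longrightarrow> G (A \<inter> B) \<longleftrightarrow> G A \<and> G B"
    and top: "G U" and bot: "\<not> G {}"
    and counts: "image_mset (true_count U G) (mset_set (pairs U)) =
      image_mset (true_count U (\<lambda>A. S \<subseteq> A)) (mset_set (pairs U))"
  obtains T where "T \<subseteq> U" "card T = card S" "\<And>A. A \<subseteq> U \<Longrightarrow> G A \<longleftrightarrow> T \<subseteq> A"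
proof -
  have finP: "finite (pairs U)"
    by (rule finite_subset[of _ "Pow U"]) (use U in \<open>auto simp: pairs_def\<close>)
  have img: "true_count U G ` pairs U = true_count U (\<lambda>A. S \<subseteq> A) ` pairs U"
    using arg_cong[OF counts, of set_mset] finP by simp
  \<comment> \<open>Multiplicities, which \<open>img\<close> forgets, matter in the exceptional
    case: there the value 4 would occur at least twice on one side and at most once on the
    other.\<close>
  have cnt: "card {I \<in> pairs U. true_count U G I = v} =
      card {I \<in> pairs U. true_count U (\<lambda>A. S \<subseteq> A) I = v}" for v
  proof -
    have "card {I \<in> pairs U. h I = v} = count (image_mset h (mset_set (pairs U))) v"
      for h :: "'a set \<Rightarrow> nat"
    proof -
      have "{I. I \<in># mset_set (pairs U) \<and> v = h I} = {I \<in> pairs U. h I = v}" using finP by auto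
      then show ?thesis using finP by (simp add: count_image_mset')
    qed
    then show ?thesis using counts by metis
  qed
  \<comment> \<open>This is the only way meets could fail: two sets sharing \<open>p\<close> are
    true but \<open>{p}\<close> is not. Then the minors at \<open>{p, q}\<close> and
    \<open>{p, r}\<close> have 4 true points each and the one at \<open>{r, s}\<close> has 2. A
    conjunction on four positions showing both values has \<open>card S = 2\<close>, and then only
    the pair \<open>S\<close> itself gives 4.\<close>
  have exceptional: False
    if d: "distinct [p, q, r, s]" and U4: "U = {p, q, r, s}"
      and G: "G {p, q}" "G {p, r}" "\<not> G {p}" for p q r s
  proof -
    have c4: "card U = 4" using d U4 by simp
    \<comment> \<open>Neither \<open>{q}\<close> nor \<open>{p, r}\<close> separates
      \<open>p\<close> from \<open>r\<close>, so \<open>meet\<close> applies, and the intersection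
      is empty.\<close>
    have nq: "\<not> G {q}"
      using meet[of p r "{q}" "{p, r}"] d G bot U4 by auto
    have P: "{p, q} \<in> pairs U" "{p, r} \<in> pairs U" "{r, s} \<in> pairs U"
      using d U4 by (auto simp: pairs_def)
    have diag: "true_count U G {x, y} = 4" if xy: "x \<noteq> y" "x \<in> U" "y \<in> U" "G {x, y}" for x y
    proof -
      \<comment> \<open>Intersecting \<open>A\<close> with \<open>{x, y}\<close> gives either
        \<open>{x, y}\<close>, which is true, or \<open>{}\<close>, which is false.\<close>
      have "G A \<longleftrightarrow> {x, y} \<subseteq> A" if A: "A \<subseteq> U" "{x, y} \<subseteq> A \<or> {x, y} \<inter> A = {}" for A
      proof -
        have "G (A \<inter> {x, y}) \<longleftrightarrow> G A \<and> G {x, y}"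
        proof (rule meet[OF xy(2,3,1) A(1)])
          show "{x, y} \<subseteq> U" using xy by simp
          show "x \<in> A \<longleftrightarrow> y \<in> A" using A(2) by blast
        qed simp
        moreover have "{x, y} \<subseteq> A \<Longrightarrow> A \<inter> {x, y} = {x, y}"
          and "\<not> {x, y} \<subseteq> A \<Longrightarrow> A \<inter> {x, y} = {}" using A(2) by blast+
        ultimately show ?thesis using bot xy(4) by metis
      qed
      then have "true_count U G {x, y} = true_count U (\<lambda>A. {x, y} \<subseteq> A) {x, y}"
        by (rule true_count_cong)
      also have "\<dots> = 2 ^ (4 - 2)"
        using true_count_conj_inside[OF U(1), of "{x, y}" "{x, y}"] xy c4 by simp
      finally show ?thesis by simp
    qed
    have N4: "true_count U G {p, q} = 4" "true_count U G {p, r} = 4"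
      by (rule diag; use G d U4 in simp)+
    \<comment> \<open>Both \<open>r\<close> and \<open>s\<close> lie outside \<open>{p, q}\<close>,
      so \<open>G A\<close> can be tested on \<open>A \<inter> {p, q}\<close>. Of the four possible
      intersections only \<open>{p, q}\<close> is true.\<close>
    have "G A \<longleftrightarrow> {p, q} \<subseteq> A" if A: "A \<subseteq> U" "{r, s} \<subseteq> A \<or> {r, s} \<inter> A = {}" for A
    proof -
      have "G (A \<inter> {p, q}) \<longleftrightarrow> G A \<and> G {p, q}"
      proof (rule meet[OF _ _ _ A(1)])
        show "r \<in> U" "s \<in> U" "{p, q} \<subseteq> U" unfolding U4 by simp_all
        show "r \<noteq> s" "r \<in> {p, q} \<longleftrightarrow> s \<in> {p, q}" using d by auto
        show "r \<in> A \<longleftrightarrow> s \<in> A" using A(2) by blast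
      qed
      moreover have "A \<inter> {p, q} = {} \<or> A \<inter> {p, q} = {p} \<or> A \<inter> {p, q} = {q} \<or> {p, q} \<subseteq> A"
        by blast
      moreover have "{p, q} \<subseteq> A \<Longrightarrow> A \<inter> {p, q} = {p, q}" by blast
      moreover have "{p, q} \<subseteq> A \<Longrightarrow> A \<inter> {p, q} \<noteq> {p}" "{p, q} \<subseteq> A \<Longrightarrow> A \<inter> {p, q} \<noteq> {q}"
        using d by auto
      ultimately show ?thesis using bot G nq by metis
    qed
    then have "true_count U G {r, s} = true_count U (\<lambda>A. {p, q} \<subseteq> A) {r, s}"
      by (rule true_count_cong)
    also have "\<dots> = 2 ^ (4 - 1 - 2)"
      using true_count_conj_outside[OF U(1) _ P(3), of "{p, q}"] d U4 c4 by auto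
    finally have N2: "true_count U G {r, s} = 2" by simp
    obtain I where I: "I \<in> pairs U" "true_count U (\<lambda>A. S \<subseteq> A) I = 4"
      using img P(1) N4(1) by (metis (no_types, lifting) imageE imageI)
    obtain J where J: "J \<in> pairs U" "true_count U (\<lambda>A. S \<subseteq> A) J = 2"
      using img P(3) N2 by (metis (no_types, lifting) imageE imageI)
    have val: "true_count U (\<lambda>A. S \<subseteq> A) K = (if K \<subseteq> S then 2 ^ (4 - card S) else 2 ^ (3 - card S))"
      if "K \<in> pairs U" for K
      using true_count_conj_inside[OF U(1) S] true_count_conj_outside[OF U(1) S that] c4 by auto
    have finS: "finite S" using U S finite_subset by auto
    have "card S \<le> 4" using card_mono[OF U(1) S] c4 by simp
    then consider "card S = 0" | "card S = 1" | "card S = 2" | "card S = 3" | "card S = 4" by linarith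
    \<comment> \<open>For sizes 0 to 4 the counts that occur are 8; 4; 4 and 2; 2 and 1; 1. Only
      size 2 shows both 4 and 2.\<close>
    then have cS: "card S = 2"
    proof cases
      case 2
      have "\<not> K \<subseteq> S" if "K \<in> pairs U" for K
        using 2 that card_mono[OF finS, of K] by (auto simp: pairs_def)
      then show ?thesis using val[OF J(1)] J 2 by simp
    qed (use val[OF I(1)] val[OF J(1)] I(2) J(2) in \<open>simp_all split: if_splits\<close>)
    have "{I \<in> pairs U. true_count U (\<lambda>A. S \<subseteq> A) I = 4} \<subseteq> {S}"
    proof
      fix K assume "K \<in> {I \<in> pairs U. true_count U (\<lambda>A. S \<subseteq> A) I = 4}"
      then have K: "K \<in> pairs U" "true_count U (\<lambda>A. S \<subseteq> A) K = 4" by blast+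
      then have "K \<subseteq> S" using val[OF K(1)] cS by (simp split: if_splits)
      then show "K \<in> {S}" using K(1) cS card_subset_eq[OF finS] by (simp add: pairs_def)
    qed
    from card_mono[OF _ this] have "card {I \<in> pairs U. true_count U G I = 4} \<le> 1"
      unfolding cnt by simp
    moreover have "{{p, q}, {p, r}} \<subseteq> {I \<in> pairs U. true_count U G I = 4}"
      using P N4 by blast
    then have "card {{p, q}, {p, r}} \<le> card {I \<in> pairs U. true_count U G I = 4}"
      using finP by (intro card_mono) simp_all
    moreover have "{p, q} \<noteq> {p, r}" using d by (auto simp: doubleton_eq_iff)
    then have "card {{p, q}, {p, r}} = 2" by simp
    ultimately show False by simp
  qed
  have meet': "G (A \<inter> B) \<longleftrightarrow> G A \<and> G B" if AB: "A \<subseteq> U" "B \<subseteq> U" for A B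
  proof (cases "inj_on (\<lambda>x. (x \<in> A, x \<in> B)) U")
    case False
    then obtain x y where "x \<in> U" "y \<in> U" "x \<noteq> y" "x \<in> A \<longleftrightarrow> y \<in> A" "x \<in> B \<longleftrightarrow> y \<in> B"
      unfolding inj_on_def by blast
    then show ?thesis using meet AB by blast
  next
    case inj: True
    let ?h = "\<lambda>x. (x \<in> A, x \<in> B)"
    have "card (?h ` U) = card U" using card_image[OF inj] .
    moreover have "card (UNIV :: (bool \<times> bool) set) = 4"
      by (simp add: UNIV_Times_UNIV[symmetric] card_cartesian_product del: UNIV_Times_UNIV)
    \<comment> \<open>There are at least four positions but only four membership patterns, so
      injectivity forces a bijection and \<open>U\<close> has exactly four elements.\<close>
    ultimately have "?h ` U = UNIV"
      using U by (intro card_seteq) (auto simp del: UNIV_Times_UNIV)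
    then have sur: "\<exists>x\<in>U. ?h x = z" for z by (metis (no_types, lifting) UNIV_I imageE)
    obtain p where p: "p \<in> U" "p \<in> A" "p \<in> B" using sur[of "(True, True)"] by auto
    obtain q where q: "q \<in> U" "q \<in> A" "q \<notin> B" using sur[of "(True, False)"] by auto
    obtain r where r: "r \<in> U" "r \<notin> A" "r \<in> B" using sur[of "(False, True)"] by auto
    obtain s where s: "s \<in> U" "s \<notin> A" "s \<notin> B" using sur[of "(False, False)"] by auto
    have d: "distinct [p, q, r, s]" using p q r s by auto
    have eq: "x = y" if "x \<in> U" "y \<in> U" "x \<in> A \<longleftrightarrow> y \<in> A" "x \<in> B \<longleftrightarrow> y \<in> B" for x y
      using inj_onD[OF inj, of x y] that by simp
    have "x \<in> {p, q, r, s}" if "x \<in> U" for x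
      using eq[OF that p(1)] eq[OF that q(1)] eq[OF that r(1)] eq[OF that s(1)] p q r s
      by (cases "x \<in> A"; cases "x \<in> B") simp_all
    then have U4: "U = {p, q, r, s}" using p q r s by blast
    have A: "A = {p, q}" using AB p q r s U4 by blast
    have B: "B = {p, r}" using AB p q r s U4 by blast
    \<comment> \<open>Two positions outside both sets make \<open>meet\<close> applicable, which
      gives monotonicity above \<open>{p}\<close>. Hence only the converse could fail, and
      \<open>exceptional\<close> rules that out.\<close>
    have "G {p} \<longrightarrow> G {p, q}" using meet[of r s "{p}" "{p, q}"] d U4 by auto
    moreover have "G {p} \<longrightarrow> G {p, r}" using meet[of q s "{p}" "{p, r}"] d U4 by auto
    moreover have "A \<inter> B = {p}" using A B d by auto
    ultimately show ?thesis using exceptional[OF d U4] unfolding A B by metis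
  qed
  \<comment> \<open>The candidate index set is the least true set: \<open>top\<close> keeps the
    family nonempty, and its finiteness makes \<open>T\<close> itself true.\<close>
  define T where "T = \<Inter> {A. A \<subseteq> U \<and> G A}"
  have TU: "T \<subseteq> U" using top by (auto simp: T_def)
  have *: "G (\<Inter> F)" if "finite F" "F \<noteq> {}" "F \<subseteq> {A. A \<subseteq> U \<and> G A}" for F
    using that
  proof (induction F rule: finite_ne_induct)
    case (insert A F)
    then have "\<Inter> F \<subseteq> U" by auto
    then show ?case using insert meet'[of A "\<Inter> F"] by auto
  qed auto
  have GT: "G T" unfolding T_def
    by (rule *) (use U top in \<open>auto intro: finite_subset[of _ "Pow U"]\<close>)
  have iff: "G A \<longleftrightarrow> T \<subseteq> A" if "A \<subseteq> U" for A
  proof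
    show "G A \<Longrightarrow> T \<subseteq> A" using that by (auto simp: T_def)
    assume "T \<subseteq> A"
    then have "A \<inter> T = T" by auto
    then show "G A" using meet'[OF that TU] GT by simp
  qed
  have "true_count U G I = true_count U (\<lambda>A. T \<subseteq> A) I" for I
    using iff by (intro true_count_cong) simp
  then have "true_count U G = true_count U (\<lambda>A. T \<subseteq> A)" by auto
  then have "card T = card S"
    using true_count_conj_less[of U S T] true_count_conj_less[of U T S] img U S TU by auto
  with TU iff that show ?thesis by blast
qed

section \<open>Identification minors as restrictions\<close>

definition duplicate :: "nat \<Rightarrow> nat \<Rightarrow> 'a list \<Rightarrow> 'a list" where
  "duplicate i j a = take j a @ a ! i # drop j a"

lemma nth_duplicate:
  assumes "length a = n - 1" "i < j" "j < n" "l < n"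
  shows "duplicate i j a ! l = a ! (if l < j then l else if l = j then i else l - 1)"
  using assms by (auto simp: duplicate_def nth_append nth_Cons' min_def)

lemma duplicate_in_tuples:
  assumes "a \<in> tuples (n - 1)" "i < j" "j < n"
  shows "duplicate i j a \<in> tuples n"
  using assms by (auto simp: duplicate_def tuples_def)

lemma duplicate_map:
  assumes "a \<in> tuples (n - 1)" "i < j" "j < n"
  shows "duplicate i j (map h a) = map h (duplicate i j a)"
  using assms by (simp add: duplicate_def tuples_def take_map drop_map)

lemma duplicate_map2:
  assumes "a \<in> tuples (n - 1)" "b \<in> tuples (n - 1)" "i < j" "j < n"
  shows "duplicate i j (map2 h a b) = map2 h (duplicate i j a) (duplicate i j b)"
  using assms by (simp add: duplicate_def tuples_def take_map drop_map take_zip drop_zip)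

lemma duplicate_replicate:
  assumes "i < j" "j < n"
  shows "duplicate i j (replicate (n - 1) x) = replicate n x"
proof (rule nth_equalityI)
  show len: "length (duplicate i j (replicate (n - 1) x)) = length (replicate n x)"
    using assms by (auto simp: duplicate_def)
  show "duplicate i j (replicate (n - 1) x) ! l = replicate n x ! l"
    if "l < length (duplicate i j (replicate (n - 1) x))" for l
    using assms that len by (subst nth_duplicate[of _ n]) auto
qed

text \<open>Deleting entry \<open>j\<close> is the inverse on tuples where it repeats entry
  \<open>i\<close>. Through this bijection a minor is read as the restriction of \<open>f\<close> to
  such tuples.\<close>

lemma bij_betw_duplicate:
  assumes "i < j" "j < n"
  shows "bij_betw (duplicate i j) (tuples (n - 1)) {b \<in> tuples n. b ! i = b ! j}"
proof (rule bij_betw_byWitness[where f' = "\<lambda>b. take j b @ drop (Suc j) b"])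
  show "\<forall>a\<in>tuples (n - 1). take j (duplicate i j a) @ drop (Suc j) (duplicate i j a) = a"
    using assms by (auto simp: duplicate_def tuples_def)
  show "\<forall>b\<in>{b \<in> tuples n. b ! i = b ! j}. duplicate i j (take j b @ drop (Suc j) b) = b"
    using assms by (auto simp: duplicate_def tuples_def nth_append min_def id_take_nth_drop[symmetric])
  show "duplicate i j ` tuples (n - 1) \<subseteq> {b \<in> tuples n. b ! i = b ! j}"
    using assms by (auto simp: tuples_def nth_duplicate[of _ n] duplicate_in_tuples[unfolded tuples_def, simplified])
  show "(\<lambda>b. take j b @ drop (Suc j) b) ` {b \<in> tuples n. b ! i = b ! j} \<subseteq> tuples (n - 1)"
    using assms by (auto simp: tuples_def)
qed

lemma pairs_cases:
  fixes n :: nat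
  assumes "I \<in> pairs {..<n}"
  obtains i j where "i < j" "j < n" "I = {i, j}" "Min I = i" "Max I = j"
proof -
  obtain x y where xy: "I = {x, y}" "x \<noteq> y" using assms by (auto simp: pairs_def card_2_iff)
  show ?thesis
    by (rule that[of "min x y" "max x y"]) (use xy assms in \<open>auto simp: pairs_def min_def max_def\<close>)
qed

lemma identification_minor_apply:
  assumes "a \<in> tuples (n - 1)"
  shows "identification_minor n f I a = f (duplicate (Min I) (Max I) a)"
  using assms by (simp add: identification_minor_def duplicate_def)

lemma identification_minor_bool_funs: "identification_minor n f I \<in> bool_funs (n - 1)"
  by (auto simp: identification_minor_def bool_funs_def)

lemma identification_minorE:
  assumes "b \<in> tuples n" "b ! i = b ! j" "i < j" "j < n"
  obtains a where "a \<in> tuples (n - 1)" "duplicate i j a = b"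
    "\<And>f. identification_minor n f {i, j} a = f b"
proof -
  have "b \<in> duplicate i j ` tuples (n - 1)"
    using bij_betw_imp_surj_on[OF bij_betw_duplicate[OF assms(3,4)]] assms(1,2) by simp
  then obtain a where a: "a \<in> tuples (n - 1)" "duplicate i j a = b" by blast
  have "identification_minor n f {i, j} a = f b" for f
    using identification_minor_apply[OF a(1), of f "{i, j}"] a(2) assms(3) by simp
  with a that show ?thesis by blast
qed

section \<open>Passage between tuples and sets of positions\<close>

definition point :: "nat \<Rightarrow> nat set \<Rightarrow> bool list" where
  "point n A = map (\<lambda>i. i \<in> A) [0..<n]"

lemma point_in_tuples: "point n A \<in> tuples n"
  by (simp add: point_def tuples_def)

lemma nth_point: "i < n \<Longrightarrow> point n A ! i \<longleftrightarrow> i \<in> A"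
  by (simp add: point_def)

lemma point_nth: "a \<in> tuples n \<Longrightarrow> point n {i. i < n \<and> a ! i} = a"
  by (auto simp: point_def tuples_def intro: nth_equalityI)

lemma point_Int: "point n (A \<inter> B) = map2 (\<and>) (point n A) (point n B)"
  by (auto simp: point_def intro: nth_equalityI)

text \<open>Both sides count the true points of \<open>f\<close> that agree at \<open>i\<close> and
  \<open>j\<close>: the left one through \<open>duplicate\<close>, the right one through
  \<open>point\<close>.\<close>

lemma card_true_minor:
  assumes "I \<in> pairs {..<n}"
  shows "card {a \<in> tuples (n - 1). identification_minor n f I a} =
    true_count {..<n} (\<lambda>A. f (point n A)) I"
proof -
  obtain i j where ij: "i < j" "j < n" "I = {i, j}" "Min I = i" "Max I = j"
    using pairs_cases[OF assms] .
  let ?T = "{b \<in> tuples n. b ! i = b ! j \<and> f b}"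
  have img: "duplicate i j ` {a \<in> tuples (n - 1). identification_minor n f I a} = ?T"
  proof
    show "duplicate i j ` {a \<in> tuples (n - 1). identification_minor n f I a} \<subseteq> ?T"
    proof (rule image_subsetI)
      fix a assume "a \<in> {a \<in> tuples (n - 1). identification_minor n f I a}"
      then have a: "a \<in> tuples (n - 1)" "identification_minor n f I a" by auto
      have "duplicate i j a \<in> {b \<in> tuples n. b ! i = b ! j}"
        using bij_betw_apply[OF bij_betw_duplicate[OF ij(1,2)] a(1)] .
      then show "duplicate i j a \<in> ?T"
        using a ij(4,5) by (simp add: identification_minor_apply)
    qed
    show "?T \<subseteq> duplicate i j ` {a \<in> tuples (n - 1). identification_minor n f I a}"
    proof
      fix b assume b: "b \<in> ?T"
      then obtain a where "a \<in> tuples (n - 1)" "duplicate i j a = b"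
          "\<And>f. identification_minor n f {i, j} a = f b"
        using identification_minorE[of b n i j] ij(1,2) by blast
      then show "b \<in> duplicate i j ` {a \<in> tuples (n - 1). identification_minor n f I a}"
        using b ij(3) by blast
    qed
  qed
  have "inj_on (duplicate i j) {a \<in> tuples (n - 1). identification_minor n f I a}"
    by (rule inj_on_subset[OF bij_betw_imp_inj_on[OF bij_betw_duplicate[OF ij(1,2)]]]) auto
  from card_image[OF this] have "card {a \<in> tuples (n - 1). identification_minor n f I a} = card ?T"
    unfolding img by (rule sym)
  moreover have "bij_betw (point n)
      {A. A \<subseteq> {..<n} \<and> (I \<subseteq> A \<or> I \<inter> A = {}) \<and> f (point n A)} ?T"
  proof (rule bij_betw_byWitness[where f' = "\<lambda>b. {l. l < n \<and> b ! l}"])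
    let ?D = "{A. A \<subseteq> {..<n} \<and> (I \<subseteq> A \<or> I \<inter> A = {}) \<and> f (point n A)}"
    have "{l. l < n \<and> point n A ! l} = A" if "A \<subseteq> {..<n}" for A
      using that nth_point by blast
    then show "\<forall>A\<in>?D. {l. l < n \<and> point n A ! l} = A" by blast
    show "\<forall>b\<in>?T. point n {l. l < n \<and> b ! l} = b" by (simp add: point_nth)
    show "point n ` ?D \<subseteq> ?T"
    proof (rule image_subsetI)
      fix A assume A: "A \<in> ?D"
      then have "i \<in> A \<longleftrightarrow> j \<in> A" unfolding ij(3) by blast
      then show "point n A \<in> ?T" using A ij(1,2) by (simp add: nth_point point_in_tuples)
    qed
    show "(\<lambda>b. {l. l < n \<and> b ! l}) ` ?T \<subseteq> ?D"
    proof (rule image_subsetI)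
      fix b assume b: "b \<in> ?T"
      let ?B = "{l. l < n \<and> b ! l}"
      have "f (point n ?B)" using b point_nth by auto
      moreover have "I \<subseteq> ?B \<or> I \<inter> ?B = {}" using b ij(1-3) by auto
      ultimately show "?B \<in> ?D" by blast
    qed
  qed
  then have "true_count {..<n} (\<lambda>A. f (point n A)) I = card ?T"
    unfolding true_count_def by (rule bij_betw_same_card)
  ultimately show ?thesis by simp
qed

section \<open>Invariants of decks\<close>

text \<open>A deck records only equivalence classes. An invariant can be evaluated on a class
  through a chosen representative, so equal decks yield equal multisets of values.\<close>

lemma deck_eq_invariant:
  assumes "deck n g = deck n f"
    and inv: "\<And>h h'. (h, h') \<in> fun_equiv (n - 1) \<Longrightarrow> \<phi> h = \<phi> h'"
  shows "image_mset (\<lambda>I. \<phi> (identification_minor n g I)) (mset_set (pairs {..<n})) =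
    image_mset (\<lambda>I. \<phi> (identification_minor n f I)) (mset_set (pairs {..<n}))"
proof -
  define \<psi> where "\<psi> X = \<phi> (SOME h. h \<in> X)" for X
  have "\<psi> (fun_equiv (n - 1) `` {h}) = \<phi> h" if "h \<in> bool_funs (n - 1)" for h
  proof -
    have "h \<in> fun_equiv (n - 1) `` {h}" using equiv_class_self[OF equiv_fun_equiv that] .
    then have "(SOME h'. h' \<in> fun_equiv (n - 1) `` {h}) \<in> fun_equiv (n - 1) `` {h}"
      by (rule someI[where P = "\<lambda>h'. h' \<in> fun_equiv (n - 1) `` {h}"])
    then show ?thesis unfolding \<psi>_def by (simp add: inv)
  qed
  then have "image_mset \<psi> (deck n f) =
      image_mset (\<lambda>I. \<phi> (identification_minor n f I)) (mset_set (pairs {..<n}))" for f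
    unfolding deck_def pairs_def multiset.map_comp comp_def
    using identification_minor_bool_funs by (intro image_mset_cong) blast
  then show ?thesis using assms(1) by metis
qed

text \<open>Truth values serve as the invariant: the values for \<open>f\<close> are all
  \<open>True\<close>, hence so are those for \<open>g\<close>.\<close>

lemma deck_eq_property:
  assumes "deck n g = deck n f"
    and "\<And>h h'. (h, h') \<in> fun_equiv (n - 1) \<Longrightarrow> P h \<longleftrightarrow> P h'"
    and "\<And>I. I \<in> pairs {..<n} \<Longrightarrow> P (identification_minor n f I)"
    and "I \<in> pairs {..<n}"
  shows "P (identification_minor n g I)"
proof -
  have fin: "finite (pairs {..<n})"
    by (rule finite_subset[of _ "Pow {..<n}"]) (auto simp: pairs_def)
  have "(\<lambda>I. P (identification_minor n g I)) ` pairs {..<n} =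
      (\<lambda>I. P (identification_minor n f I)) ` pairs {..<n}"
    using arg_cong[OF deck_eq_invariant[where \<phi> = P, OF assms(1,2)], of set_mset] fin by simp
  then show ?thesis using assms(3,4) by blast
qed

section \<open>Two invariants: the number of true points and preservation of meets\<close>

lemma permute_list_in_tuples: "a \<in> tuples n \<Longrightarrow> permute_list s a \<in> tuples n"
  by (simp add: tuples_def)

lemma finite_tuples: "finite (tuples n)"
  using finite_lists_length_eq[of "UNIV :: bool set" n] by (simp add: tuples_def)

text \<open>An injection of true points suffices, since symmetry of \<open>fun_equiv\<close>
  supplies the reverse inequality.\<close>

lemma card_true_fun_equiv_le:
  assumes "(h, h') \<in> fun_equiv n"
  shows "card {a \<in> tuples n. h a} \<le> card {a \<in> tuples n. h' a}"
proof -
  obtain s where s: "s permutes {..<n}" "\<And>a. a \<in> tuples n \<Longrightarrow> h a = h' (permute_list s a)"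
    using assms by (auto simp: fun_equiv_def)
  have "permute_list (inv s) (permute_list s a) = a" if "a \<in> tuples n" for a
    using permute_list_compose[of "inv s" a s] permutes_inv[OF s(1)] permutes_inv_o[OF s(1)] that
    by (simp add: tuples_def)
  then have "inj_on (permute_list s) (tuples n)" by (rule inj_on_inverseI)
  then show ?thesis
    by (intro card_inj_on_le[of "permute_list s"])
      (auto simp: inj_on_def s(2) permute_list_in_tuples finite_tuples)
qed

lemma fun_equiv_sym: "(h, h') \<in> fun_equiv n \<Longrightarrow> (h', h) \<in> fun_equiv n"
  using equivE[OF equiv_fun_equiv] by (meson symD)

text \<open>These are the conjunctions over nonempty index sets, described without naming the set.
  In this form the property passes easily to equivalent functions and to minors, because
  \<open>permute_list\<close> and \<open>duplicate\<close> commute with \<open>map2\<close> and send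
  constant tuples to constant tuples.\<close>

definition bounded_meet_hom :: "nat \<Rightarrow> (bool list \<Rightarrow> bool) \<Rightarrow> bool" where
  "bounded_meet_hom n h \<longleftrightarrow>
     (\<forall>a\<in>tuples n. \<forall>b\<in>tuples n. h (map2 (\<and>) a b) \<longleftrightarrow> h a \<and> h b) \<and>
     h (replicate n True) \<and> \<not> h (replicate n False)"

lemma permute_list_map2:
  assumes "length a = length b" "s permutes {..<length b}"
  shows "permute_list s (map2 h a b) = map2 h (permute_list s a) (permute_list s b)"
  using assms by (simp add: permute_list_map permute_list_zip)

lemma permute_list_replicate:
  assumes "s permutes {..<n}"
  shows "permute_list s (replicate n x) = replicate n x"
  using permutes_in_image[OF assms]
  by (intro nth_equalityI) (simp_all add: permute_list_nth assms)

lemma bounded_meet_hom_fun_equiv_imp: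
  assumes "(h, h') \<in> fun_equiv n" "bounded_meet_hom n h'"
  shows "bounded_meet_hom n h"
proof -
  obtain s where s: "s permutes {..<n}" "\<And>a. a \<in> tuples n \<Longrightarrow> h a = h' (permute_list s a)"
    using assms(1) by (auto simp: fun_equiv_def)
  have "h (map2 (\<and>) a b) \<longleftrightarrow> h a \<and> h b" if ab: "a \<in> tuples n" "b \<in> tuples n" for a b
  proof -
    have "map2 (\<and>) a b \<in> tuples n" using ab by (simp add: tuples_def)
    moreover have "permute_list s (map2 (\<and>) a b) = map2 (\<and>) (permute_list s a) (permute_list s b)"
      using ab s(1) by (intro permute_list_map2) (simp_all add: tuples_def)
    ultimately show ?thesis
      using assms(2) ab unfolding bounded_meet_hom_def by (simp add: s(2) permute_list_in_tuples)
  qed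
  moreover have "h (replicate n x) = h' (replicate n x)" for x
    using s(2)[of "replicate n x"] by (simp add: tuples_def permute_list_replicate[OF s(1)])
  ultimately show ?thesis using assms(2) by (simp add: bounded_meet_hom_def)
qed

lemma bounded_meet_hom_minor:
  assumes "bounded_meet_hom n f" "I \<in> pairs {..<n}"
  shows "bounded_meet_hom (n - 1) (identification_minor n f I)"
proof -
  obtain i j where ij: "i < j" "j < n" "I = {i, j}" "Min I = i" "Max I = j"
    using pairs_cases[OF assms(2)] .
  have map2: "map2 h a b \<in> tuples (n - 1)" if "a \<in> tuples (n - 1)" "b \<in> tuples (n - 1)"
    for a b and h :: "bool \<Rightarrow> bool \<Rightarrow> bool" using that by (simp add: tuples_def)
  have rep: "replicate (n - 1) x \<in> tuples (n - 1)" for x by (simp add: tuples_def)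
  show ?thesis
    using assms(1) ij(1,2) unfolding bounded_meet_hom_def
    by (simp add: identification_minor_apply map2 rep ij(4,5) duplicate_map2[of _ n]
      duplicate_replicate[of _ _ n] duplicate_in_tuples del: One_nat_def)
qed

lemma bounded_meet_hom_fun_equiv:
  "(h, h') \<in> fun_equiv n \<Longrightarrow> bounded_meet_hom n h \<longleftrightarrow> bounded_meet_hom n h'"
  using bounded_meet_hom_fun_equiv_imp fun_equiv_sym by blast

text \<open>A bijection from \<open>S\<close> to \<open>T\<close> and one between their complements
  in \<open>U\<close> are glued, with the identity outside \<open>U\<close>.\<close>

lemma permutes_image_exists:
  assumes "finite U" "S \<subseteq> U" "T \<subseteq> U" "card S = card T"
  obtains s where "s permutes U" "s ` S = T"
proof -
  have fin: "finite S" "finite T" using assms finite_subset by auto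
  obtain f where f: "bij_betw f S T" using finite_same_card_bij[OF fin assms(4)] by blast
  have "card (U - S) = card (U - T)" using assms fin by (simp add: card_Diff_subset)
  then obtain g where g: "bij_betw g (U - S) (U - T)"
    using finite_same_card_bij[of "U - S" "U - T"] assms(1) by blast
  define s where "s x = (if x \<in> S then f x else if x \<in> U then g x else x)" for x
  have sS: "bij_betw s S T" using f by (rule bij_betw_cong[THEN iffD1, rotated]) (simp add: s_def)
  have "bij_betw s (U - S) (U - T)"
    using g by (rule bij_betw_cong[THEN iffD1, rotated]) (simp add: s_def)
  from bij_betw_combine[OF sS this] have "bij_betw s U U"
    using assms(2,3) by (simp add: Un_absorb1)
  then have "s permutes U"
    by (rule bij_imp_permutes) (use assms(2) in \<open>auto simp: s_def\<close>)
  then show ?thesis using that bij_betw_imp_surj_on[OF sS] by blast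
qed

lemma conj_fun_equiv:
  assumes "S \<subseteq> {..<n}" "T \<subseteq> {..<n}" "card S = card T"
  shows "(\<lambda>a\<in>tuples n. \<forall>i\<in>S. a ! i, \<lambda>a\<in>tuples n. \<forall>i\<in>T. a ! i) \<in> fun_equiv n"
proof -
  \<comment> \<open>The permutation goes from \<open>T\<close> to \<open>S\<close>, because entry
    \<open>i\<close> of the permuted tuple is \<open>a ! s i\<close>.\<close>
  obtain s where s: "s permutes {..<n}" "s ` T = S"
    using permutes_image_exists[of "{..<n}" T S] assms by auto
  have "(\<forall>i\<in>S. a ! i) \<longleftrightarrow> (\<forall>i\<in>T. permute_list s a ! i)" if "a \<in> tuples n" for a
  proof -
    have "permute_list s a ! i = a ! s i" if "i \<in> T" for i
      using that assms(2) \<open>a \<in> tuples n\<close> s(1) by (intro permute_list_nth) (auto simp: tuples_def)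
    then show ?thesis unfolding s(2)[symmetric] by simp
  qed
  then show ?thesis
    using s(1) by (auto simp: fun_equiv_def bool_funs_def permute_list_in_tuples)
qed

section \<open>Reconstruction\<close>

text \<open>Among three entries two coincide, so every value of \<open>g\<close> is a value of one
  of its minors, and the deck forces all minors to be constantly \<open>c\<close>.\<close>

lemma reconstructible_const:
  assumes n: "n \<ge> 3"
  shows "reconstructible n (\<lambda>a\<in>tuples n. c)"
  unfolding reconstructible_def
proof (intro allI impI)
  let ?f = "\<lambda>a\<in>tuples n. c"
  fix g assume "is_reconstruction n ?f g"
  then have g: "g \<in> bool_funs n" and deck: "deck n g = deck n ?f"
    by (auto simp: is_reconstruction_def)
  have minor: "\<forall>a\<in>tuples (n - 1). identification_minor n g I a = c" if "I \<in> pairs {..<n}" for I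
  proof (rule deck_eq_property[OF deck _ _ that])
    show "(\<forall>a\<in>tuples (n - 1). h a = c) \<longleftrightarrow> (\<forall>a\<in>tuples (n - 1). h' a = c)"
      if "(h, h') \<in> fun_equiv (n - 1)" for h h'
    proof -
      have imp: "\<forall>a\<in>tuples (n - 1). h a = c"
        if "(h, h') \<in> fun_equiv (n - 1)" "\<forall>a\<in>tuples (n - 1). h' a = c" for h h'
        using that by (auto simp: fun_equiv_def permute_list_in_tuples)
      show ?thesis using imp[OF that] imp[OF fun_equiv_sym[OF that]] by blast
    qed
    fix J assume "J \<in> pairs {..<n}"
    then obtain i j where "i < j" "j < n" "Min J = i" "Max J = j" using pairs_cases by metis
    then show "\<forall>a\<in>tuples (n - 1). identification_minor n ?f J a = c"
      by (simp add: identification_minor_apply duplicate_in_tuples del: One_nat_def)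
  qed
  have "g b = c" if b: "b \<in> tuples n" for b
  proof -
    have "b ! 0 = b ! 1 \<or> b ! 0 = b ! 2 \<or> b ! 1 = b ! 2" by blast
    then obtain i j where ij: "i < j" "j < n" "b ! i = b ! j"
      using n by (metis One_nat_def Suc_1 Suc_le_lessD lessI less_trans numeral_3_eq_3 zero_less_one
          zero_less_numeral)
    obtain a where "a \<in> tuples (n - 1)" "\<And>f. identification_minor n f {i, j} a = f b"
      using identification_minorE[OF b ij(3,1,2)] by metis
    moreover have "{i, j} \<in> pairs {..<n}" using ij by (auto simp: pairs_def)
    ultimately show ?thesis using minor by blast
  qed
  then have "g = ?f"
    using g by (intro extensionalityI[of g "tuples n"]) (auto simp: bool_funs_def PiE_def)
  then show "(?f, g) \<in> fun_equiv n"
    using g equiv_class_self[OF equiv_fun_equiv g] by simp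
qed

text \<open>The deck is used twice: every minor of \<open>g\<close> preserves meets and bounds, as
  those of the conjunction do, and the numbers of true points agree as multisets.\<close>

lemma reconstructible_conj:
  assumes n: "n \<ge> 4" and S: "S \<subseteq> {..<n}" "S \<noteq> {}"
  shows "reconstructible n (\<lambda>a\<in>tuples n. \<forall>i\<in>S. a ! i)"
  unfolding reconstructible_def
proof (intro allI impI)
  let ?f = "\<lambda>a\<in>tuples n. \<forall>i\<in>S. a ! i"
  fix g assume "is_reconstruction n ?f g"
  then have g: "g \<in> bool_funs n" and deck: "deck n g = deck n ?f"
    by (auto simp: is_reconstruction_def)
  have nth: "i < n" if "i \<in> S" for i using that S by auto
  have "map2 (\<and>) a b \<in> tuples n" if "a \<in> tuples n" "b \<in> tuples n" for a b
    using that by (simp add: tuples_def)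
  moreover have "(\<forall>i\<in>S. map2 (\<and>) a b ! i) \<longleftrightarrow> (\<forall>i\<in>S. a ! i) \<and> (\<forall>i\<in>S. b ! i)"
    if "a \<in> tuples n" "b \<in> tuples n" for a b
    using that nth by (auto simp: tuples_def)
  moreover have "replicate n x \<in> tuples n" for x by (simp add: tuples_def)
  moreover have "(\<forall>i\<in>S. replicate n x ! i) \<longleftrightarrow> x" for x using nth S(2) by auto
  ultimately have "bounded_meet_hom n ?f" by (simp add: bounded_meet_hom_def)
  then have f_minor: "bounded_meet_hom (n - 1) (identification_minor n ?f I)"
    if "I \<in> pairs {..<n}" for I
    using that by (rule bounded_meet_hom_minor)
  have minor: "bounded_meet_hom (n - 1) (identification_minor n g I)" if "I \<in> pairs {..<n}" for I
    by (rule deck_eq_property[where P = "bounded_meet_hom (n - 1)",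
        OF deck bounded_meet_hom_fun_equiv f_minor that])
  define G where "G A = g (point n A)" for A
  \<comment> \<open>Everything is read off the minor at \<open>{i, j}\<close>: agreement at
    \<open>i\<close> and \<open>j\<close> is what lets the points of \<open>A\<close> and
    \<open>B\<close> come from that minor, and the two constant tuples come from every
    minor.\<close>
  have restr: "(G (A \<inter> B) \<longleftrightarrow> G A \<and> G B) \<and> G {..<n} \<and> \<not> G {}"
    if ij: "i < j" "j < n" and hom: "i \<in> A \<longleftrightarrow> j \<in> A" "i \<in> B \<longleftrightarrow> j \<in> B" for i j A B
  proof -
    have I: "{i, j} \<in> pairs {..<n}" using ij by (auto simp: pairs_def)
    have mm: "Min {i, j} = i" "Max {i, j} = j" using ij by auto
    have "\<exists>a\<in>tuples (n - 1). duplicate i j a = point n A" if "i \<in> A \<longleftrightarrow> j \<in> A" for A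
      using identification_minorE[OF point_in_tuples _ ij, of A] ij that
      by (metis nth_point order.strict_trans)
    then obtain a b where ab: "a \<in> tuples (n - 1)" "duplicate i j a = point n A"
        "b \<in> tuples (n - 1)" "duplicate i j b = point n B"
      using hom by metis
    have t: "map2 (\<and>) a b \<in> tuples (n - 1)" "replicate (n - 1) x \<in> tuples (n - 1)" for x
      using ab by (auto simp: tuples_def)
    have p: "point n {..<n} = replicate n True" "point n {} = replicate n False"
      by (auto simp: point_def intro: nth_equalityI)
    let ?m = "identification_minor n g {i, j}"
    have "?m (map2 (\<and>) a b) \<longleftrightarrow> ?m a \<and> ?m b"
      "?m (replicate (n - 1) True)" "\<not> ?m (replicate (n - 1) False)"
      using minor[OF I] ab(1,3) by (simp_all add: bounded_meet_hom_def del: One_nat_def)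
    moreover have "?m a = G A" "?m b = G B" "?m (map2 (\<and>) a b) = G (A \<inter> B)"
      "?m (replicate (n - 1) True) = G {..<n}" "?m (replicate (n - 1) False) = G {}"
      unfolding identification_minor_apply[OF ab(1)] identification_minor_apply[OF ab(3)]
        identification_minor_apply[OF t(1)] identification_minor_apply[OF t(2)]
        mm G_def p point_Int duplicate_map2[OF ab(1,3) ij] duplicate_replicate[OF ij] ab(2,4)
      by (rule refl)+
    ultimately show ?thesis by simp
  qed
  have counts: "image_mset (true_count {..<n} G) (mset_set (pairs {..<n})) =
      image_mset (true_count {..<n} (\<lambda>A. S \<subseteq> A)) (mset_set (pairs {..<n}))"
  proof -
    have fin: "finite (pairs {..<n})"
      by (rule finite_subset[of _ "Pow {..<n}"]) (auto simp: pairs_def)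
    have f: "?f (point n A) \<longleftrightarrow> S \<subseteq> A" for A
      using nth by (auto simp: point_in_tuples nth_point)
    let ?N = "\<lambda>h. card {a \<in> tuples (n - 1). h a}"
    have "image_mset (true_count {..<n} G) (mset_set (pairs {..<n})) =
        image_mset (\<lambda>I. ?N (identification_minor n g I)) (mset_set (pairs {..<n}))"
    proof (rule image_mset_cong)
      fix I assume "I \<in># mset_set (pairs {..<n})"
      then have "I \<in> pairs {..<n}" using fin by simp
      then show "true_count {..<n} G I = ?N (identification_minor n g I)"
        unfolding G_def by (rule card_true_minor[symmetric])
    qed
    also have "\<dots> = image_mset (\<lambda>I. ?N (identification_minor n ?f I)) (mset_set (pairs {..<n}))"
    proof (rule deck_eq_invariant[where \<phi> = ?N, OF deck])
      fix h h' assume "(h, h') \<in> fun_equiv (n - 1)"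
      from card_true_fun_equiv_le[OF this] card_true_fun_equiv_le[OF fun_equiv_sym[OF this]]
      show "?N h = ?N h'" by simp
    qed
    also have "\<dots> = image_mset (true_count {..<n} (\<lambda>A. S \<subseteq> A)) (mset_set (pairs {..<n}))"
    proof (rule image_mset_cong)
      fix I assume "I \<in># mset_set (pairs {..<n})"
      then have "I \<in> pairs {..<n}" using fin by simp
      then show "?N (identification_minor n ?f I) = true_count {..<n} (\<lambda>A. S \<subseteq> A) I"
        unfolding f[symmetric] by (rule card_true_minor)
    qed
    finally show ?thesis .
  qed
  obtain T where T: "T \<subseteq> {..<n}" "card T = card S" "\<And>A. A \<subseteq> {..<n} \<Longrightarrow> G A \<longleftrightarrow> T \<subseteq> A"
  proof (rule conj_of_minor_counts[OF _ _ S(1) _ _ _ counts])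
    show "finite {..<n}" "card {..<n} \<ge> 4" using n by auto
    \<comment> \<open>Any pair of positions yields the bounds; the empty sets are mere placeholders
      for \<open>A\<close> and \<open>B\<close>.\<close>
    show "G {..<n}" "\<not> G {}" using restr[of 0 1 "{}" "{}"] n by auto
    fix x y :: nat and A B
    assume "x \<in> {..<n}" "y \<in> {..<n}" "x \<noteq> y" "x \<in> A \<longleftrightarrow> y \<in> A" "x \<in> B \<longleftrightarrow> y \<in> B"
    then show "G (A \<inter> B) \<longleftrightarrow> G A \<and> G B"
      using restr[of x y A B] restr[of y x A B] by (cases x y rule: linorder_cases) auto
  qed blast
  have "g a \<longleftrightarrow> (\<forall>i\<in>T. a ! i)" if a: "a \<in> tuples n" for a
  proof -
    have "g a \<longleftrightarrow> G {i. i < n \<and> a ! i}" using point_nth[OF a] by (simp add: G_def)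
    also have "\<dots> \<longleftrightarrow> T \<subseteq> {i. i < n \<and> a ! i}" by (rule T(3)) auto
    finally show ?thesis using T(1) by auto
  qed
  then have "g = (\<lambda>a\<in>tuples n. \<forall>i\<in>T. a ! i)"
    using g by (intro extensionalityI[of g "tuples n"]) (auto simp: bool_funs_def PiE_def)
  then show "(?f, g) \<in> fun_equiv n"
    using conj_fun_equiv[OF S(1) T(1)] T(2) by simp
qed

section \<open>Duality\<close>

definition dual :: "nat \<Rightarrow> (bool list \<Rightarrow> bool) \<Rightarrow> bool list \<Rightarrow> bool" where
  "dual n f = (\<lambda>a\<in>tuples n. \<not> f (map Not a))"

lemma map_Not_in_tuples: "a \<in> tuples n \<Longrightarrow> map Not a \<in> tuples n"
  by (simp add: tuples_def)

lemma dual_bool_funs: "dual n f \<in> bool_funs n"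
  by (auto simp: dual_def bool_funs_def)

lemma dual_dual:
  assumes "f \<in> bool_funs n"
  shows "dual n (dual n f) = f"
proof (rule extensionalityI[of _ "tuples n"])
  show "f \<in> extensional (tuples n)" using assms by (auto simp: bool_funs_def PiE_def)
qed (auto simp: dual_def map_Not_in_tuples comp_def)

lemma dual_fun_equiv:
  assumes "(f, g) \<in> fun_equiv n"
  shows "(dual n f, dual n g) \<in> fun_equiv n"
proof -
  obtain s where s: "s permutes {..<n}" "\<And>a. a \<in> tuples n \<Longrightarrow> f a = g (permute_list s a)"
    using assms by (auto simp: fun_equiv_def)
  have "dual n f a = dual n g (permute_list s a)" if a: "a \<in> tuples n" for a
  proof -
    have "map Not (permute_list s a) = permute_list s (map Not a)"
      using s(1) a by (simp add: permute_list_map tuples_def)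
    then show ?thesis
      using a by (simp add: dual_def permute_list_in_tuples map_Not_in_tuples s(2))
  qed
  then show ?thesis using s(1) by (auto simp: fun_equiv_def dual_bool_funs)
qed

text \<open>Since \<open>dual\<close> is an involution preserving equivalence, it maps classes onto
  whole classes, not merely into them.\<close>

lemma dual_fun_equiv_class:
  assumes "h \<in> bool_funs n"
  shows "fun_equiv n `` {dual n h} = dual n ` (fun_equiv n `` {h})"
proof
  show "dual n ` (fun_equiv n `` {h}) \<subseteq> fun_equiv n `` {dual n h}"
    using dual_fun_equiv by auto
  show "fun_equiv n `` {dual n h} \<subseteq> dual n ` (fun_equiv n `` {h})"
  proof
    fix g assume "g \<in> fun_equiv n `` {dual n h}"
    then have g: "(dual n h, g) \<in> fun_equiv n" by simp
    then have "g \<in> bool_funs n" by (auto simp: fun_equiv_def)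
    then have "g = dual n (dual n g)" by (simp add: dual_dual)
    moreover have "(h, dual n g) \<in> fun_equiv n" using dual_fun_equiv[OF g] dual_dual[OF assms] by simp
    ultimately show "g \<in> dual n ` (fun_equiv n `` {h})" by blast
  qed
qed

lemma identification_minor_dual:
  assumes "I \<in> pairs {..<n}"
  shows "identification_minor n (dual n f) I = dual (n - 1) (identification_minor n f I)"
proof -
  obtain i j where ij: "i < j" "j < n" "Min I = i" "Max I = j" using pairs_cases[OF assms] by metis
  have "identification_minor n (dual n f) I a = dual (n - 1) (identification_minor n f I) a"
    if a: "a \<in> tuples (n - 1)" for a
    using a ij
    by (simp add: dual_def identification_minor_apply duplicate_in_tuples duplicate_map[of _ n]
      map_Not_in_tuples del: One_nat_def)
  then show ?thesis
    by (intro extensionalityI[of _ "tuples (n - 1)"]) (auto simp: dual_def identification_minor_def)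
qed

lemma deck_dual: "deck n (dual n f) = image_mset ((`) (dual (n - 1))) (deck n f)"
proof -
  have "finite {I. I \<subseteq> {..<n} \<and> card I = 2}"
    by (rule finite_subset[of _ "Pow {..<n}"]) auto
  then show ?thesis
    unfolding deck_def multiset.map_comp comp_def
    by (intro image_mset_cong)
      (simp add: identification_minor_dual pairs_def dual_fun_equiv_class
        identification_minor_bool_funs del: One_nat_def)
qed

text \<open>By \<open>deck_dual\<close>, a reconstruction of \<open>f\<close> dualises to one of
  \<open>dual n f\<close>; the resulting equivalence is then dualised back.\<close>

lemma reconstructible_dual:
  assumes "reconstructible n (dual n f)" "f \<in> bool_funs n"
  shows "reconstructible n f"
  unfolding reconstructible_def
proof (intro allI impI)
  fix g assume "is_reconstruction n f g"
  then have g: "g \<in> bool_funs n" "deck n g = deck n f" by (auto simp: is_reconstruction_def)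
  then have "is_reconstruction n (dual n f) (dual n g)"
    by (simp add: is_reconstruction_def dual_bool_funs deck_dual)
  then have "(dual n f, dual n g) \<in> fun_equiv n" using assms(1) by (simp add: reconstructible_def)
  from dual_fun_equiv[OF this] show "(f, g) \<in> fun_equiv n"
    using g(1) assms(2) by (simp add: dual_dual)
qed

lemma reconstructible_disj:
  assumes "n \<ge> 4" "S \<subseteq> {..<n}" "S \<noteq> {}"
  shows "reconstructible n (\<lambda>a\<in>tuples n. \<exists>i\<in>S. a ! i)"
proof (rule reconstructible_dual)
  \<comment> \<open>By De Morgan the dual of the disjunction is the conjunction over the same
    \<open>S\<close>.\<close>
  have "(\<exists>i\<in>S. map Not a ! i) \<longleftrightarrow> \<not> (\<forall>i\<in>S. a ! i)" if "a \<in> tuples n" for a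
    using that assms(2) by (auto simp: tuples_def subset_iff)
  then have "dual n (\<lambda>a\<in>tuples n. \<exists>i\<in>S. a ! i) = (\<lambda>a\<in>tuples n. \<forall>i\<in>S. a ! i)"
    unfolding dual_def by (intro restrict_ext) (simp add: map_Not_in_tuples)
  then show "reconstructible n (dual n (\<lambda>a\<in>tuples n. \<exists>i\<in>S. a ! i))"
    using reconstructible_conj[OF assms] by simp
qed (simp add: bool_funs_def)

theorem corollary4p12:
  fixes C :: fun_class
  assumes "C = clone_Lambda \<or> C = clone_V"
  shows "reconstructible_class (arity_at_least C 4)"
proof -
  have "reconstructible n f" if "(n, f) \<in> C" "n \<ge> 4" for n f
    using assms that reconstructible_const[of n] reconstructible_conj[of n] reconstructible_disj[of n]
    by (elim disjE) (auto simp: clone_Lambda_iff clone_V_iff)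
  then show ?thesis by (auto simp: reconstructible_class_def arity_at_least_def)
qed

end
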